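(* Let $(X,\mathcal F)$ be any metric fractal. Then: (i) $(X,\mathcal F)$ is isometrically equivalent to a fractal in the Banach space $C[0,1]$; (ii) $(X,\mathcal F)$ is isometrically equivalent to a fractal in the Banach space $\ell_\infty$; (iii) $(X,\mathcal F)$ is bi-Lipschitz equivalent to a fractal in the Banach space $c_0$.
   Context: A self-map $f$ of a metric space $(M,d)$ is contracting if its Lipschitz constant $\mathrm{Lip}(f)=\sup_{x\neq y} d(f(x),f(y))/d(x,y)$ is $<1$. A metric fractal is a pair $(X,\mathcal F)$ consisting of a (non-empty) compact metric space $X$ and a finite family $\mathcal F$ of contracting self-maps of $X$ with $X=\bigcup_{f\in\mathcal F}f(X)$. A fractal in a complete metric space $M$ is a metric fractal $(L,\mathcal G)$ such that $L\subset M$ carries the metric inherited from $M$ and each $g\in\mathcal G$ is the restriction to $L$ of a contracting self-map of $M$ (equivalently, $L$ is the attractor of a finite system of contracting self-maps of $M$ and $\mathcal G$ is the set of restrictions of these maps to $L$). Two metric fractals $(X,\mathcal F_X)$, $(Y,\mathcal F_Y)$ are isometrically (resp. bi-Lipschitz) equivalent if there is a homeomorphism $h:X\to Y$ with $\mathcal F_Y=\{h\circ f\circ h^{-1}:f\in\mathcal F_X\}$ which is an isometry (resp. bi-Lipschitz, i.e. there are $c,C>0$ with $c\,d_X(x,y)\le d_Y(h(x),h(y))\le C\,d_X(x,y)$ for all $x,y\in X$). $C[0,1]$ is the Banach space of continuous real-valued functions on $[0,1]$ with the sup-norm, $\ell_\infty$ is the Banach space of bounded real sequences with the sup-norm, and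 $c_0$ is its subspace of sequences converging to $0$. *)

theory Defs
  imports "HOL-Analysis.Analysis"
begin

section \<open>Metric fractals\<close>

text \<open>
  A metric space is given by a subset of a type of class \<open>metric_space\<close>, with the inherited
  distance.  Maps between such subsets are extensional functions, so that the equality of two
  maps on \<open>X\<close> is the equality of HOL functions, and sets of maps can be compared with \<open>=\<close>.
\<close>

text \<open>The supremum is taken in \<open>ennreal\<close>, so it is \<open>0\<close> when \<open>S\<close> has at most one point and
  \<open>\<infinity>\<close> when \<open>f\<close> is not Lipschitz on \<open>S\<close>.\<close>

definition Lip :: "'a::metric_space set \<Rightarrow> ('a \<Rightarrow> 'b::metric_space) \<Rightarrow> ennreal" where
  "Lip S f =
     (SUP (x, y) \<in> {(x, y). x \<in> S \<and> y \<in> S \<and> x \<noteq> y}. ennreal (dist (f x) (f y) / dist x y))"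

definition contracting_self_maps :: "'a::metric_space set \<Rightarrow> ('a \<Rightarrow> 'a) set" where
  "contracting_self_maps S = {f \<in> S \<rightarrow>\<^sub>E S. Lip S f < 1}"

definition metric_fractal :: "'a::metric_space set \<Rightarrow> ('a \<Rightarrow> 'a) set \<Rightarrow> bool" where
  "metric_fractal X F \<longleftrightarrow>
     X \<noteq> {} \<and> compact X \<and> finite F \<and> F \<subseteq> contracting_self_maps X \<and> X = (\<Union>f\<in>F. f ` X)"

definition fractal_in :: "'a::metric_space set \<Rightarrow> 'a set \<Rightarrow> ('a \<Rightarrow> 'a) set \<Rightarrow> bool" where
  "fractal_in M L G \<longleftrightarrow>
     complete M \<and> L \<subseteq> M \<and> metric_fractal L G \<and>
     (\<forall>g\<in>G. \<exists>f \<in> contracting_self_maps M. g = restrict f L)"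

definition conjugates_family ::
  "'a::metric_space set \<Rightarrow> ('a \<Rightarrow> 'a) set \<Rightarrow> 'b::metric_space set \<Rightarrow> ('b \<Rightarrow> 'b) set
    \<Rightarrow> ('a \<Rightarrow> 'b) \<Rightarrow> bool" where
  "conjugates_family X F Y G h \<longleftrightarrow>
     (\<exists>k. homeomorphism X Y h k \<and> G = (\<lambda>f. restrict (h \<circ> f \<circ> k) Y) ` F)"

definition isometrically_equivalent ::
  "'a::metric_space set \<Rightarrow> ('a \<Rightarrow> 'a) set \<Rightarrow> 'b::metric_space set \<Rightarrow> ('b \<Rightarrow> 'b) set \<Rightarrow> bool" where
  "isometrically_equivalent X F Y G \<longleftrightarrow>
     (\<exists>h. conjugates_family X F Y G h \<and> (\<forall>x\<in>X. \<forall>y\<in>X. dist (h x) (h y) = dist x y))"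

definition bi_Lipschitz_equivalent ::
  "'a::metric_space set \<Rightarrow> ('a \<Rightarrow> 'a) set \<Rightarrow> 'b::metric_space set \<Rightarrow> ('b \<Rightarrow> 'b) set \<Rightarrow> bool" where
  "bi_Lipschitz_equivalent X F Y G \<longleftrightarrow>
     (\<exists>h. conjugates_family X F Y G h \<and>
       (\<exists>c>0. \<exists>C>0. \<forall>x\<in>X. \<forall>y\<in>X.
          c * dist x y \<le> dist (h x) (h y) \<and> dist (h x) (h y) \<le> C * dist x y))"

lemma Lip_less_1_iff: "Lip S f < 1 \<longleftrightarrow> (\<exists>C<1. C-lipschitz_on S f)"
proof
  assume *: "Lip S f < 1"
  then obtain c where c: "Lip S f = ennreal c" "c \<ge> 0"
    by (cases "Lip S f") auto
  have "c < 1" using * c by (simp add: ennreal_less_one_iff)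
  moreover have "c-lipschitz_on S f"
  proof (rule lipschitz_onI)
    fix x y assume xy: "x \<in> S" "y \<in> S"
    show "dist (f x) (f y) \<le> c * dist x y"
    proof (cases "x = y")
      case False
      have "ennreal (dist (f x) (f y) / dist x y) \<le> ennreal c"
        unfolding c(1)[symmetric] Lip_def by (rule SUP_upper2[of "(x, y)"]) (use xy False in auto)
      then have "dist (f x) (f y) / dist x y \<le> c"
        using c(2) by (simp add: ennreal_le_iff)
      then show ?thesis using False by (simp add: divide_le_eq)
    qed auto
  qed fact
  ultimately show "\<exists>C<1. C-lipschitz_on S f" by blast
next
  assume "\<exists>C<1. C-lipschitz_on S f"
  then obtain C where C: "C < 1" "C-lipschitz_on S f" by blast
  have "Lip S f \<le> ennreal C"
    unfolding Lip_def
  proof (rule SUP_least, clarify)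
    fix x y assume "x \<in> S" "y \<in> S" "x \<noteq> y"
    then show "ennreal (dist (f x) (f y) / dist x y) \<le> ennreal C"
      using lipschitz_onD[OF C(2), of x y] by (intro ennreal_leI) (simp add: divide_le_eq)
  qed
  also have "ennreal C < 1"
    using C lipschitz_on_nonneg by (auto simp: ennreal_less_one_iff)
  finally show "Lip S f < 1" .
qed


section \<open>The Banach spaces\<close>

typedef unit_interval = "{0..1::real}"
  by (rule exI[of _ 0]) auto

instantiation unit_interval :: metric_space
begin

definition dist_unit_interval :: "unit_interval \<Rightarrow> unit_interval \<Rightarrow> real" where
  "dist_unit_interval s t = dist (Rep_unit_interval s) (Rep_unit_interval t)"

definition uniformity_unit_interval :: "(unit_interval \<times> unit_interval) filter" where
  "uniformity_unit_interval = (INF e\<in>{0<..}. principal {(s, t). dist s t < e})"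

definition open_unit_interval :: "unit_interval set \<Rightarrow> bool" where
  "open_unit_interval U \<longleftrightarrow> (\<forall>s\<in>U. \<forall>\<^sub>F (s', t) in uniformity. s' = s \<longrightarrow> t \<in> U)"

instance
proof
  fix s t u :: unit_interval
  show "dist s t = 0 \<longleftrightarrow> s = t"
    by (simp add: dist_unit_interval_def Rep_unit_interval_inject)
  show "dist s t \<le> dist s u + dist t u"
    unfolding dist_unit_interval_def by (rule dist_triangle2)
qed (rule uniformity_unit_interval_def open_unit_interval_def)+

end

text \<open>
  Every continuous real function on the compact space \<open>[0,1]\<close> is bounded
  (\<open>bcontfun_unit_interval\<close> below), so \<open>C[0,1]\<close> is the Banach space of bounded continuous
  functions on it.  Similarly \<open>nat\<close> is discrete, so that the bounded continuous functions on it
  are the bounded sequences.  The norm of both is the sup-norm.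
\<close>

type_synonym C01 = "unit_interval \<Rightarrow>\<^sub>C real"
type_synonym l_infty = "nat \<Rightarrow>\<^sub>C real"

definition c0 :: "l_infty set" where
  "c0 = {x. apply_bcontfun x \<longlonglongrightarrow> 0}"

lemma homeomorphism_unit_interval:
  "homeomorphism UNIV {0..1} Rep_unit_interval Abs_unit_interval"
proof -
  have "continuous_on UNIV Rep_unit_interval"
    unfolding continuous_on_iff by (auto simp: dist_unit_interval_def)
  moreover have "continuous_on {0..1} Abs_unit_interval"
    unfolding continuous_on_iff by (auto simp: dist_unit_interval_def Abs_unit_interval_inverse)
  moreover have "Rep_unit_interval ` UNIV = {0..1}"
    using type_definition.Rep_range[OF type_definition_unit_interval] .
  ultimately show ?thesis
    by (auto simp: homeomorphism_def Rep_unit_interval_inverse Abs_unit_interval_inverse image_iff)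
      (metis Rep_unit_interval Rep_unit_interval_inverse atLeastAtMost_iff)
qed

lemma compact_unit_interval: "compact (UNIV :: unit_interval set)"
  using compact_continuous_image[of "{0..1}" Abs_unit_interval] homeomorphism_unit_interval
  by (auto simp: homeomorphism_def)

lemma bcontfun_unit_interval:
  "bcontfun = {f :: unit_interval \<Rightarrow> real. continuous_on UNIV f}"
  using compact_continuous_image[OF _ compact_unit_interval]
  by (auto simp: bcontfun_def intro: compact_imp_bounded)

lemma bcontfun_nat: "bcontfun = {x :: nat \<Rightarrow> real. bounded (range x)}"
  by (auto simp: bcontfun_def)

lemma subspace_c0: "subspace c0"
  unfolding subspace_def c0_def
  by (auto intro: tendsto_add_zero tendsto_mult_right_zero)

lemma closed_c0: "closed c0"
  unfolding closed_sequential_limits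
proof (intro allI impI, elim conjE)
  fix X and x :: l_infty
  assume X: "\<forall>n. X n \<in> c0" and lim: "X \<longlonglongrightarrow> x"
  have "apply_bcontfun x \<longlonglongrightarrow> 0"
  proof (rule swap_uniform_limit'[where f = "\<lambda>n. apply_bcontfun (X n)" and F = sequentially and g = "\<lambda>_. 0" and S = UNIV])
    show "\<forall>\<^sub>F n in sequentially. (apply_bcontfun (X n) \<longlongrightarrow> 0) sequentially"
      using X by (simp add: c0_def)
    show "uniform_limit UNIV (\<lambda>n. apply_bcontfun (X n)) x sequentially"
      using lim by (rule tendsto_bcontfun_uniform_limit)
  qed auto
  then show "x \<in> c0" by (simp add: c0_def)
qed

end

theory Submission
  imports Defs
begin

text \<open>
  If \<open>h\<close> embeds \<open>X\<close> into a space \<open>M\<close> with \<open>c d(x,y) \<le> d(h x, h y) \<le> d(x,y)\<close> and the maps of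
  \<open>\<F>\<close> are \<open>q\<close>-Lipschitz, then the conjugated maps on \<open>h(X)\<close> are \<open>(q/c)\<close>-Lipschitz.  So it
  suffices to have such an embedding with \<open>q < c\<close>, and to extend Lipschitz self-maps of the
  compact set \<open>h(X)\<close> to \<open>M\<close> with the same constant (\<open>fractal_in_of_embedding\<close>).

  Extension.  In a space of bounded continuous functions of \<open>t\<close> the McShane formula
  \<open>G(x)(t) = inf {g(y)(t) + C d(x,y) | y \<in> L}\<close>, applied at each \<open>t\<close> separately, extends \<open>g\<close>
  without loss in the constant.  That \<open>G(x)\<close> is again continuous is where compactness of \<open>L\<close>
  enters: \<open>g(L)\<close> is compact and hence equicontinuous (\<open>lipschitz_extension_bcontfun\<close>).  In \<open>c\<^sub>0\<close>
  the compact set \<open>g(L)\<close> lies between \<open>-e\<close> and \<open>e\<close> for some \<open>e \<in> c\<^sub>0\<close>, and truncating \<open>G(x)\<close> at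
  \<open>\<plusminus>e\<close> forces the values into \<open>c\<^sub>0\<close> (\<open>lipschitz_extension_c0\<close>).

  Embedding.  For \<open>\<ell>\<^sub>\<infinity>\<close> take Frechet's map \<open>x \<mapsto> (d(x, p\<^sub>n))\<^sub>n\<close> for a dense sequence.  For \<open>c\<^sub>0\<close>
  the coordinate \<open>d(x, p\<^sub>n)\<close> is cut off at a multiple of the mesh of the net to which \<open>p\<^sub>n\<close>
  belongs; as the nets get finer the cut-offs tend to \<open>0\<close>, while two points at distance \<open>d\<close> are
  told apart by the net whose mesh is a small multiple of \<open>d\<close>.  This gives every \<open>c < 1\<close>
  (\<open>almost_isometric_embedding_c0\<close>), in particular some \<open>c > q\<close>.  For \<open>C[0,1]\<close> one needs a
  continuous family \<open>u\<^sub>t\<close> of 1-Lipschitz functions on \<open>X\<close>, \<open>0 \<le> t \<le> 1\<close>, that contains the functions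
  \<open>d(-, p)\<close> for a dense set of points \<open>p\<close>.  The fractal structure provides it: the points
  \<open>p\<^sub>w = f\<^bsub>w(1)\<^esub> \<dots> f\<^bsub>w(n)\<^esub> x\<^sub>0\<close>, indexed by finite words, are dense, and they are a Hoelder function
  of suitable addresses of the words in \<open>[0,1]\<close>.  If \<open>\<omega>\<close> denotes the Hoelder modulus, then
  \<open>u\<^sub>t(x) = inf {d(x, p\<^sub>w) + \<omega>(|t - address w|) | w}\<close> is such a family (\<open>isometric_embedding_C01\<close>).
\<close>

section \<open>Infima of nearby families\<close>

lemma abs_dist_diff_le_left: "\<bar>dist x z - dist y z\<bar> \<le> dist x y"
  using abs_dist_diff_le[of x z y] by (simp add: dist_commute)

text \<open>
  Both infima that are formed below, over the points of a compact set and over words, inherit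
  their Lipschitz constants and their continuity from the single terms through this estimate.
\<close>

lemma abs_INF_diff_le:
  fixes a b :: "'i \<Rightarrow> real"
  assumes "I \<noteq> {}" "bdd_below (a ` I)" "bdd_below (b ` I)"
    and ab: "\<And>i. i \<in> I \<Longrightarrow> \<bar>a i - b i\<bar> \<le> e"
  shows "\<bar>(INF i\<in>I. a i) - (INF i\<in>I. b i)\<bar> \<le> e"
proof -
  have half: "(INF i\<in>I. a i) - e \<le> (INF i\<in>I. b i)"
    if "bdd_below (a ` I)" "\<And>i. i \<in> I \<Longrightarrow> a i \<le> b i + e" for a b :: "'i \<Rightarrow> real"
  proof (rule cINF_greatest)
    fix i assume "i \<in> I"
    then show "(INF i\<in>I. a i) - e \<le> b i"
      using cINF_lower[OF that(1) \<open>i \<in> I\<close>] that(2)[of i] by linarith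
  qed fact
  have "(INF i\<in>I. a i) - e \<le> (INF i\<in>I. b i)" "(INF i\<in>I. b i) - e \<le> (INF i\<in>I. a i)"
    using ab by (intro half assms(2,3); force simp: abs_le_iff)+
  then show ?thesis by linarith
qed

section \<open>Compactness and completeness for the sup-norm\<close>

text \<open>
  A Cauchy sequence for the sup-norm converges uniformly, and a uniform limit of bounded
  continuous functions is bounded and continuous.  The domain is an arbitrary topological space,
  so that it can be the discrete space of natural numbers.
\<close>

lemma complete_bcontfun:
  "complete (UNIV :: ('t::topological_space \<Rightarrow>\<^sub>C 'b::complete_space) set)"
  unfolding complete_def
proof (intro allI impI, elim conjE)
  fix f :: "nat \<Rightarrow> 't \<Rightarrow>\<^sub>C 'b" assume f: "Cauchy f"
  have "uniformly_Cauchy_on UNIV (\<lambda>n. apply_bcontfun (f n))"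
  proof (rule uniformly_Cauchy_onI)
    fix e :: real assume "e > 0"
    then obtain N where "\<forall>m\<ge>N. \<forall>n\<ge>N. dist (f m) (f n) < e" using f unfolding Cauchy_def by blast
    then show "\<exists>N. \<forall>t\<in>UNIV. \<forall>m\<ge>N. \<forall>n\<ge>N. dist (f m t) (f n t) < e"
      by (intro exI[of _ N] ballI allI impI dist_fun_lt_imp_dist_val_lt) simp
  qed
  then obtain g where "uniform_limit UNIV (\<lambda>n. apply_bcontfun (f n)) g sequentially"
    using Cauchy_uniformly_convergent by (auto simp: uniformly_convergent_on_def)
  then obtain l where "f \<longlonglongrightarrow> l" by (rule uniform_limit_bcontfunE[OF _ sequentially_bot])
  then show "\<exists>l\<in>UNIV. f \<longlonglongrightarrow> l" by blast
qed

text \<open>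
  One half of the Arzela--Ascoli theorem.  Evaluation at \<open>t\<close>, and hence the limit \<open>l\<close>, is
  1-Lipschitz for the sup-norm, so it is enough to control the limits on a finite \<open>e/3\<close>-net.
  With the neighbourhoods of a point for \<open>A\<close> this is equicontinuity of compact sets of continuous
  functions; with \<open>sequentially\<close> it is uniform decay of compact subsets of \<open>c\<^sub>0\<close>.
\<close>

lemma compact_bcontfun_uniform_tendsto:
  fixes K :: "('t::topological_space \<Rightarrow>\<^sub>C real) set"
  fixes l :: "('t \<Rightarrow>\<^sub>C real) \<Rightarrow> real"
  assumes "compact K" and lim: "\<And>v. v \<in> K \<Longrightarrow> (apply_bcontfun v \<longlongrightarrow> l v) A" and "e > 0"
  shows "\<forall>\<^sub>F t in A. \<forall>v\<in>K. \<bar>apply_bcontfun v t - l v\<bar> < e"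
proof (cases "A = bot")
  case False
  have l: "\<bar>l v - l w\<bar> \<le> dist v w" if "v \<in> K" "w \<in> K" for v w
  proof (rule tendsto_upperbound)
    show "((\<lambda>t. \<bar>v t - w t\<bar>) \<longlongrightarrow> \<bar>l v - l w\<bar>) A"
      by (intro tendsto_intros lim that)
    show "\<forall>\<^sub>F t in A. \<bar>v t - w t\<bar> \<le> dist v w"
      using dist_bounded[of v _ w] by (simp add: dist_real_def)
  qed fact
  obtain N where N: "N \<subseteq> K" "finite N" "K \<subseteq> (\<Union>v\<in>N. ball v (e/3))"
    using compactE_image[OF assms(1), of K "\<lambda>v. ball v (e/3)"] \<open>e > 0\<close> by force
  have "\<forall>\<^sub>F t in A. \<forall>w\<in>N. \<bar>apply_bcontfun w t - l w\<bar> < e/3"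
  proof (intro eventually_ball_finite[OF N(2)] ballI)
    fix w assume "w \<in> N"
    then have "(apply_bcontfun w \<longlongrightarrow> l w) A" using N lim by blast
    from tendstoD[OF this, of "e/3"] show "\<forall>\<^sub>F t in A. \<bar>apply_bcontfun w t - l w\<bar> < e/3"
      unfolding dist_real_def using \<open>e > 0\<close> by simp
  qed
  then show ?thesis
  proof eventually_elim
    case (elim t)
    show ?case
    proof
      fix v assume "v \<in> K"
      then obtain w where w: "w \<in> N" "dist w v < e/3" using N by auto
      have "\<bar>v t - w t\<bar> \<le> dist v w" "\<bar>l v - l w\<bar> \<le> dist v w" "\<bar>w t - l w\<bar> < e/3"
        using dist_bounded[of v t w] l[of v w] N w \<open>v \<in> K\<close> elim by (auto simp: dist_real_def)
      then show "\<bar>v t - l v\<bar> < e"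
        using w(2) unfolding dist_commute[of w v] by arith
    qed
  qed
qed simp

section \<open>Lipschitz extension from compact sets\<close>

text \<open>
  McShane's extension, coordinate by coordinate.  The terms of the infimum at \<open>t\<close> and at \<open>s\<close> differ
  by \<open>g y t - g y s\<close>, which is uniformly small for \<open>y \<in> L\<close> when \<open>t\<close> is near \<open>s\<close> because
  \<open>g ` L\<close> is compact; hence the extension takes values in continuous functions.
\<close>

lemma lipschitz_extension_bcontfun:
  fixes g :: "'a::metric_space \<Rightarrow> ('t::topological_space \<Rightarrow>\<^sub>C real)"
  assumes "compact L" and g: "C-lipschitz_on L g"
  obtains G where "C-lipschitz_on UNIV G" "\<And>x. x \<in> L \<Longrightarrow> G x = g x"
proof (cases "L = {}")
  case True
  show ?thesis
    by (rule that[of "\<lambda>_. 0"]) (use True g lipschitz_on_nonneg in \<open>auto simp: lipschitz_on_def\<close>)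
next
  case False
  have C: "C \<ge> 0" using g by (rule lipschitz_on_nonneg)
  have cK: "compact (g ` L)"
    using compact_continuous_image[OF lipschitz_on_continuous_on[OF g] assms(1)] .
  obtain B where "\<And>v. v \<in> g ` L \<Longrightarrow> norm v \<le> B"
    using compact_imp_bounded[OF cK] by (auto simp: bounded_iff)
  then have B: "\<bar>g y t\<bar> \<le> B" if "y \<in> L" for y t
    using norm_bounded[of "g y" t] that by fastforce
  define u where "u x t = (INF y\<in>L. g y t + C * dist x y)" for x t
  have bdd: "bdd_below ((\<lambda>y. g y t + C * dist x y) ` L)" for x t
  proof (rule bdd_belowI2)
    fix y assume "y \<in> L"
    then show "- B \<le> g y t + C * dist x y"
      using B[of y t] mult_nonneg_nonneg[OF C, of "dist x y"] by (simp add: abs_le_iff)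
  qed
  have u_lip: "\<bar>u x t - u x' t\<bar> \<le> C * dist x x'" for x x' t
    unfolding u_def
  proof (rule abs_INF_diff_le[OF False bdd bdd])
    fix y
    have "\<bar>C * (dist x y - dist x' y)\<bar> \<le> C * dist x x'"
      using abs_dist_diff_le_left[of x y x'] C
      by (simp add: abs_mult mult_left_mono dist_commute)
    then show "\<bar>g y t + C * dist x y - (g y t + C * dist x' y)\<bar> \<le> C * dist x x'"
      by (simp add: algebra_simps)
  qed
  have u_bcontfun: "u x \<in> bcontfun" for x
  proof -
    have "continuous_on UNIV (u x)"
      unfolding continuous_on_def
    proof (intro ballI tendstoI)
      fix s and e :: real assume "e > 0"
      have "\<forall>\<^sub>F t in at s. \<forall>v\<in>g ` L. \<bar>apply_bcontfun v t - apply_bcontfun v s\<bar> < e / 2"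
      proof (rule compact_bcontfun_uniform_tendsto[OF cK])
        show "(apply_bcontfun v \<longlongrightarrow> v s) (at s)" for v :: "'t \<Rightarrow>\<^sub>C real"
          using continuous_on_apply_bcontfun[of UNIV v] by (simp add: continuous_on_def)
      qed (use \<open>e > 0\<close> in simp)
      then show "\<forall>\<^sub>F t in at s within UNIV. dist (u x t) (u x s) < e"
      proof eventually_elim
        case (elim t)
        have "\<bar>u x t - u x s\<bar> \<le> e / 2"
          unfolding u_def using elim by (intro abs_INF_diff_le[OF False bdd bdd]) fastforce
        then show ?case using \<open>e > 0\<close> by (simp add: dist_real_def)
      qed
    qed
    moreover have "bounded (range (u x))"
    proof -
      (* Comparison with the constant family 0 turns a bound for the terms into one for u. *)
      obtain M where M: "\<And>y. y \<in> L \<Longrightarrow> dist x y \<le> M"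
        using compact_imp_bounded[OF assms(1)] by (metis bounded_any_center)
      have "\<bar>u x t - (INF y\<in>L. 0)\<bar> \<le> B + C * M" for t
        unfolding u_def
      proof (rule abs_INF_diff_le[OF False bdd])
        fix y assume "y \<in> L"
        then show "\<bar>g y t + C * dist x y - 0\<bar> \<le> B + C * M"
          using B[of y t] mult_left_mono[OF M C, of y] mult_nonneg_nonneg[OF C, of "dist x y"]
          by (simp add: abs_le_iff)
      qed auto
      then show ?thesis
        using False by (auto intro!: boundedI[of _ "B + C * M"])
    qed
    ultimately show ?thesis by (simp add: bcontfun_def)
  qed
  define G where "G x = Bcontfun (u x)" for x
  have G: "apply_bcontfun (G x) = u x" for x
    unfolding G_def by (rule Bcontfun_inverse[OF u_bcontfun])
  show ?thesis
  proof
    show "C-lipschitz_on UNIV G"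
      using C u_lip by (intro lipschitz_onI dist_bound) (auto simp: G dist_real_def)
    fix x assume "x \<in> L"
    show "G x = g x"
    proof (rule bcontfun_eqI)
      fix t
      have "u x t \<le> g x t"
        unfolding u_def using cINF_lower[OF bdd \<open>x \<in> L\<close>, of t x] by simp
      moreover have "g x t \<le> u x t"
        unfolding u_def
      proof (rule cINF_greatest[OF False])
        fix y assume "y \<in> L"
        have "\<bar>g x t - g y t\<bar> \<le> C * dist x y"
          using dist_bounded[of "g x" t "g y"] lipschitz_onD[OF g \<open>x \<in> L\<close> \<open>y \<in> L\<close>]
          by (simp add: dist_real_def)
        then show "g x t \<le> g y t + C * dist x y" by linarith
      qed
      ultimately show "G x t = g x t" by (simp add: G)
    qed
  qed
qed

lemma compact_c0_dominated:
  assumes "compact K" "K \<subseteq> c0"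
  obtains e :: "nat \<Rightarrow> real" where "e \<longlonglongrightarrow> 0" "\<And>v n. v \<in> K \<Longrightarrow> \<bar>v n\<bar> \<le> e n" "\<And>n. 0 \<le> e n"
proof -
  (* Adding 0 makes the supremum below range over a non-empty set. *)
  define K' where "K' = insert 0 K"
  have K': "compact K'" "K' \<subseteq> c0" using assms subspace_0[OF subspace_c0] by (auto simp: K'_def)
  define e where "e n = (SUP v\<in>K'. \<bar>apply_bcontfun v n\<bar>)" for n
  obtain B where B: "\<And>v. v \<in> K' \<Longrightarrow> norm v \<le> B"
    using compact_imp_bounded[OF K'(1)] by (auto simp: bounded_iff)
  have "bdd_above ((\<lambda>v. \<bar>apply_bcontfun v n\<bar>) ` K')" for n
  proof (rule bdd_aboveI2)
    fix v assume "v \<in> K'"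
    then show "\<bar>apply_bcontfun v n\<bar> \<le> B"
      using B[of v] norm_bounded[of v n] by simp
  qed
  then have le: "\<bar>v n\<bar> \<le> e n" if "v \<in> K'" for v n
    unfolding e_def using that by (intro cSUP_upper)
  have pos: "0 \<le> e n" for n using le[of 0 n] by (simp add: K'_def)
  have "e \<longlonglongrightarrow> 0"
  proof (rule tendstoI)
    fix r :: real assume "r > 0"
    have "\<forall>\<^sub>F n in sequentially. \<forall>v\<in>K'. \<bar>apply_bcontfun v n - 0\<bar> < r / 2"
      using K' \<open>r > 0\<close> by (intro compact_bcontfun_uniform_tendsto) (auto simp: c0_def)
    then show "\<forall>\<^sub>F n in sequentially. dist (e n) 0 < r"
    proof eventually_elim
      case (elim n)
      then have "e n \<le> r / 2"
        unfolding e_def by (intro cSUP_least) (auto simp: K'_def intro: less_imp_le)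
      then show ?case using pos[of n] \<open>r > 0\<close> by simp
    qed
  qed
  then show ?thesis using le pos by (intro that[of e]) (auto simp: K'_def)
qed

text \<open>
  McShane's extension of a map into \<open>c\<^sub>0\<close> takes values in \<open>\<ell>\<^sub>\<infinity>\<close> only: the coordinates of
  its value at \<open>x\<close> tend to \<open>C\<close> times the distance of \<open>x\<close> from \<open>L\<close>.  Truncation at a dominating null sequence \<open>e\<close> of \<open>g ` L\<close> is a 1-Lipschitz
  map into \<open>c\<^sub>0\<close> that fixes \<open>g ` L\<close>.
\<close>

lemma lipschitz_extension_c0:
  fixes g :: "'a::metric_space \<Rightarrow> l_infty"
  assumes "compact L" and g: "C-lipschitz_on L g" and "g ` L \<subseteq> c0"
  obtains G where "C-lipschitz_on UNIV G" "range G \<subseteq> c0" "\<And>x. x \<in> L \<Longrightarrow> G x = g x"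
proof -
  obtain e :: "nat \<Rightarrow> real" where e: "e \<longlonglongrightarrow> 0" "\<And>v n. v \<in> g ` L \<Longrightarrow> \<bar>v n\<bar> \<le> e n" "\<And>n. 0 \<le> e n"
    using compact_c0_dominated[OF compact_continuous_image[OF lipschitz_on_continuous_on[OF g]]]
      assms by metis
  obtain H where H: "C-lipschitz_on UNIV H" "\<And>x. x \<in> L \<Longrightarrow> H x = g x"
    using lipschitz_extension_bcontfun[OF assms(1) g] by blast
  define u where "u x n = max (- e n) (min (e n) (H x n))" for x n
  have u_le: "\<bar>u x n\<bar> \<le> e n" for x n
    using e(3)[of n] by (auto simp: u_def)
  have u_lim: "u x \<longlonglongrightarrow> 0" for x
    by (rule Lim_null_comparison[OF _ e(1)]) (use u_le in auto)
  then have "u x \<in> bcontfun" for x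
    using convergent_imp_bounded by (auto simp: bcontfun_nat)
  then have G: "apply_bcontfun (Bcontfun (u x)) = u x" for x
    by (rule Bcontfun_inverse)
  show ?thesis
  proof
    have "\<bar>u x n - u y n\<bar> \<le> C * dist x y" for x y n
    proof -
      have "\<bar>u x n - u y n\<bar> \<le> \<bar>H x n - H y n\<bar>" by (auto simp: u_def)
      also have "\<dots> \<le> dist (H x) (H y)"
        using dist_bounded[of "H x" n "H y"] by (simp add: dist_real_def)
      also have "\<dots> \<le> C * dist x y" using lipschitz_onD[OF H(1)] by simp
      finally show ?thesis .
    qed
    then show "C-lipschitz_on UNIV (\<lambda>x. Bcontfun (u x))"
      using lipschitz_on_nonneg[OF g]
      by (intro lipschitz_onI dist_bound) (auto simp: G dist_real_def)
    show "range (\<lambda>x. Bcontfun (u x)) \<subseteq> c0"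
      using u_lim by (auto simp: c0_def G)
    show "Bcontfun (u x) = g x" if "x \<in> L" for x
    proof (rule bcontfun_eqI)
      fix n
      show "Bcontfun (u x) n = g x n"
        using e(2)[of "g x" n] that unfolding G u_def H(2)[OF that] by (auto simp: abs_le_iff)
    qed
  qed
qed

section \<open>Transport of a fractal structure along an embedding\<close>

text \<open>
  The conjugates of the maps in \<open>F\<close> lose a factor \<open>1/c\<close>, the Lipschitz constant of the inverse of
  \<open>h\<close>.  They stay contracting because \<open>q / c < 1\<close>: the closer \<open>q\<close> is to \<open>1\<close>, the closer to an
  isometry \<open>h\<close> must be.
\<close>

lemma fractal_in_of_embedding:
  fixes h :: "'a::metric_space \<Rightarrow> 'b::metric_space"
  assumes X: "metric_fractal X F"
    and M: "complete M" "h ` X \<subseteq> M"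
    and F: "\<And>f. f \<in> F \<Longrightarrow> q-lipschitz_on X f"
    and c: "0 < c" and q: "q / c < 1"
    and h: "\<And>x y. x \<in> X \<Longrightarrow> y \<in> X \<Longrightarrow> c * dist x y \<le> dist (h x) (h y)"
      "1-lipschitz_on X h"
    and ext: "\<And>g. (q/c)-lipschitz_on (h ` X) g \<Longrightarrow> g ` h ` X \<subseteq> h ` X \<Longrightarrow>
      \<exists>G. (q/c)-lipschitz_on M G \<and> G ` M \<subseteq> M \<and> (\<forall>x\<in>h ` X. G x = g x)"
  obtains G where "fractal_in M (h ` X) G" "conjugates_family X F (h ` X) G h"
proof -
  define L where "L = h ` X"
  have "inj_on h X"
    using h(1) c by (intro inj_onI) (force simp: mult_le_0_iff)
  then obtain k where k: "homeomorphism X L h k"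
    using homeomorphism_compact[of X h L] X lipschitz_on_continuous_on[OF h(2)]
    by (auto simp: L_def metric_fractal_def)
  have kX: "k y \<in> X" "h (k y) = y" if "y \<in> L" for y
    using k that by (auto simp: homeomorphism_def)
  have kh: "k (h x) = x" if "x \<in> X" for x
    using k that by (auto simp: homeomorphism_def)
  have FX: "f x \<in> X" if "f \<in> F" "x \<in> X" for f x
    using X that by (auto simp: metric_fractal_def contracting_self_maps_def)
  define conj where "conj f = restrict (h \<circ> f \<circ> k) L" for f
  have conj_into: "conj f ` L \<subseteq> L" if "f \<in> F" for f
    using kX FX[OF that] by (auto simp: conj_def L_def)
  have conj_lip: "(q/c)-lipschitz_on L (conj f)" if "f \<in> F" for f
  proof (rule lipschitz_onI)
    show "0 \<le> q / c" using lipschitz_on_nonneg[OF F[OF that]] c by simp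
    fix y z assume yz: "y \<in> L" "z \<in> L"
    have "dist (conj f y) (conj f z) \<le> dist (f (k y)) (f (k z))"
      using lipschitz_onD[OF h(2), of "f (k y)" "f (k z)"] yz kX FX[OF that]
      by (simp add: conj_def)
    also have "\<dots> \<le> q * dist (k y) (k z)"
      using lipschitz_onD[OF F[OF that], of "k y" "k z"] yz kX by simp
    also have "\<dots> \<le> q * (dist y z / c)"
      using h(1)[of "k y" "k z"] yz kX c lipschitz_on_nonneg[OF F[OF that]]
      by (intro mult_left_mono) (simp_all add: field_simps)
    finally show "dist (conj f y) (conj f z) \<le> q / c * dist y z" by simp
  qed
  have union: "L = (\<Union>g\<in>conj ` F. g ` L)"
  proof -
    have "conj f ` L = h ` f ` X" for f
    proof -
      have "conj f ` L = (\<lambda>x. conj f (h x)) ` X" by (simp add: L_def image_image)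
      also have "\<dots> = h ` f ` X" unfolding image_image
        by (rule image_cong) (simp_all add: conj_def L_def kh)
      finally show ?thesis .
    qed
    then have "(\<Union>g\<in>conj ` F. g ` L) = h ` (\<Union>f\<in>F. f ` X)" by auto
    then show ?thesis using X by (simp add: L_def metric_fractal_def)
  qed
  have ext_conj: "\<exists>G\<in>contracting_self_maps M. conj f = restrict G L" if f: "f \<in> F" for f
  proof -
    obtain G where G: "(q/c)-lipschitz_on M G" "G ` M \<subseteq> M" "\<forall>x\<in>L. G x = conj f x"
      using ext conj_lip[OF f] conj_into[OF f] by (metis L_def)
    have "(q/c)-lipschitz_on M (restrict G M)"
      using G(1) by (simp add: lipschitz_on_def)
    then have "restrict G M \<in> contracting_self_maps M"
      using G(2) q by (auto simp: contracting_self_maps_def Lip_less_1_iff)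
    moreover have "conj f = restrict (restrict G M) L"
    proof
      fix y show "conj f y = restrict (restrict G M) L y"
        using G(3) M(2) by (cases "y \<in> L") (auto simp: L_def conj_def)
    qed
    ultimately show ?thesis by blast
  qed
  have "conj f \<in> contracting_self_maps L" if f: "f \<in> F" for f
    using conj_into[OF f] conj_lip[OF f] q
    by (auto simp: contracting_self_maps_def Lip_less_1_iff) (auto simp: conj_def)
  moreover have "compact L" "L \<noteq> {}" "finite (conj ` F)"
    using X compact_continuous_image[OF lipschitz_on_continuous_on[OF h(2)]]
    by (auto simp: L_def metric_fractal_def)
  ultimately have "metric_fractal L (conj ` F)"
    using union by (auto simp: metric_fractal_def)
  then have "fractal_in M L (conj ` F)"
    using M ext_conj by (auto simp: fractal_in_def L_def)
  moreover have "conjugates_family X F L (conj ` F) h"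
    using k by (auto simp: conjugates_family_def conj_def)
  ultimately show ?thesis using that by (simp add: L_def)
qed

section \<open>Embeddings into sequence spaces\<close>

text \<open>
  A finite \<open>(1/2)^k\<close>-net for each \<open>k\<close>, arranged in one sequence \<open>p\<close>, where \<open>r n\<close> is the mesh of the net
  to which \<open>p n\<close> belongs.  The meshes tend to \<open>0\<close> because only finitely many \<open>n\<close> belong to the
  first \<open>k\<close> nets.
\<close>

lemma compact_net_sequence:
  fixes X :: "'a::metric_space set"
  assumes "compact X" "X \<noteq> {}"
  obtains p :: "nat \<Rightarrow> 'a" and r :: "nat \<Rightarrow> real"
  where "range p \<subseteq> X" "r \<longlonglongrightarrow> 0" "\<And>n. r n > 0"
    "\<And>x k. x \<in> X \<Longrightarrow> \<exists>n. dist x (p n) < (1/2)^k \<and> r n = (1/2)^k"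
proof -
  have "\<exists>N. N \<subseteq> X \<and> finite N \<and> X \<subseteq> (\<Union>z\<in>N. ball z ((1/2)^k))" for k :: nat
    using compactE_image[OF assms(1), of X "\<lambda>z. ball z ((1/2)^k)"] by force
  then obtain N where N: "\<And>k. N k \<subseteq> X" "\<And>k. finite (N k)"
    "\<And>k. X \<subseteq> (\<Union>z\<in>N k. ball z ((1/2)^k))" by metis
  (* The same point may lie in several nets, so the pairs (level, point) are enumerated. *)
  define I where "I = (SIGMA k:UNIV::nat set. N k)"
  have "countable I" unfolding I_def using N by (intro countable_SIGMA) (auto intro: countable_finite)
  moreover have "infinite I"
  proof
    assume "finite I"
    then have "finite (fst ` I)" by simp
    moreover have "fst ` I = UNIV" using N(3) assms(2) by (force simp: I_def image_iff)
    ultimately show False by simp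
  qed
  ultimately have e: "bij_betw (from_nat_into I) UNIV I" by (rule bij_betw_from_nat_into)
  define p where "p n = snd (from_nat_into I n)" for n
  define j where "j n = fst (from_nat_into I n)" for n
  have "from_nat_into I n \<in> I" for n using bij_betwE[OF e] by blast
  then have "(j n, p n) \<in> I" for n by (simp add: p_def j_def)
  then have pj: "p n \<in> N (j n)" "from_nat_into I n = (j n, p n)" for n
    by (simp only: I_def mem_Sigma_iff) (simp add: p_def j_def)
  have "filterlim j at_top sequentially"
    unfolding filterlim_at_top
  proof
    fix k
    have "finite (SIGMA i:{..<k}. N i)" using N by auto
    then have "finite (from_nat_into I -` (SIGMA i:{..<k}. N i))"
      using e by (intro finite_vimageI) (auto simp: bij_betw_def)
    moreover have "{n. \<not> k \<le> j n} \<subseteq> from_nat_into I -` (SIGMA i:{..<k}. N i)"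
      using pj by auto
    ultimately have "finite {n. \<not> k \<le> j n}" by (rule rev_finite_subset)
    then show "\<forall>\<^sub>F n in sequentially. k \<le> j n"
      by (simp add: eventually_cofinite flip: cofinite_eq_sequentially)
  qed
  then have lim: "(\<lambda>n. (1/2::real) ^ j n) \<longlonglongrightarrow> 0"
    by (rule filterlim_compose[rotated]) (simp add: LIMSEQ_power_zero)
  show ?thesis
  proof (rule that[OF _ lim])
    show "range p \<subseteq> X" using pj N by blast
    fix x and k :: nat assume "x \<in> X"
    then obtain z where z: "z \<in> N k" "dist x z < (1/2)^k" using N(3)[of k] by (auto simp: dist_commute)
    then have "(k, z) \<in> I" by (simp add: I_def)
    then obtain n where "from_nat_into I n = (k, z)" using e by (metis bij_betw_imp_surj_on imageE)
    then show "\<exists>n. dist x (p n) < (1/2)^k \<and> (1/2::real) ^ j n = (1/2)^k"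
      using z pj(2)[of n] by auto
  qed simp
qed

lemma isometric_embedding_l_infty:
  fixes X :: "'a::metric_space set"
  assumes "compact X" "X \<noteq> {}"
  obtains h :: "'a \<Rightarrow> l_infty" where "\<And>x y. x \<in> X \<Longrightarrow> y \<in> X \<Longrightarrow> dist (h x) (h y) = dist x y"
proof -
  obtain p :: "nat \<Rightarrow> 'a" and r where p: "range p \<subseteq> X"
    "\<And>x k. x \<in> X \<Longrightarrow> \<exists>n. dist x (p n) < (1/2)^k \<and> r n = (1/2::real)^k"
    using compact_net_sequence[OF assms] by metis
  define h where "h x = Bcontfun (\<lambda>n. dist x (p n))" for x
  have h: "h x n = dist x (p n)" for x n
  proof -
    have "bounded (range p)" using bounded_subset[OF compact_imp_bounded[OF assms(1)] p(1)] .
    then obtain B where "\<And>n. dist x (p n) \<le> B" by (metis bounded_any_center rangeI)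
    then have "(\<lambda>n. dist x (p n)) \<in> bcontfun"
      by (auto simp: bcontfun_nat intro!: boundedI[of _ B])
    then show ?thesis by (simp add: h_def Bcontfun_inverse)
  qed
  show ?thesis
  proof (rule that, rule antisym)
    fix x y assume "x \<in> X" "y \<in> X"
    show "dist (h x) (h y) \<le> dist x y"
      using abs_dist_diff_le_left[of x _ y] by (intro dist_bound) (simp add: h dist_real_def)
    show "dist x y \<le> dist (h x) (h y)"
    proof (rule field_le_epsilon)
      fix e :: real assume "e > 0"
      then obtain k where k: "(1/2::real)^k < e/2" using real_arch_pow_inv[of "e/2" "1/2"] by auto
      obtain n where n: "dist x (p n) < (1/2)^k" using p(2)[OF \<open>x \<in> X\<close>] by blast
      have "\<bar>dist x (p n) - dist y (p n)\<bar> \<le> dist (h x) (h y)"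
        using dist_bounded[of "h x" n "h y"] by (simp add: h dist_real_def)
      then show "dist x y \<le> dist (h x) (h y) + e"
        using n k dist_triangle2[of x y "p n"] by linarith
    qed
  qed
qed

text \<open>
  The \<open>n\<close>-th coordinate is the distance from \<open>p n\<close>, cut off at \<open>K * r n\<close>, where \<open>r n\<close> is the mesh of
  the net of \<open>p n\<close>.  Let \<open>d = dist x y\<close>.  If \<open>p n\<close> is \<open>b d\<close>-close to \<open>x\<close> and the cut-off is at least \<open>d\<close>,
  then this coordinate is at most \<open>b d\<close> at \<open>x\<close> and at least \<open>d - b d\<close> at \<open>y\<close>, which gives the
  constant \<open>1 - 2 b = c\<close>.
\<close>

lemma almost_isometric_embedding_c0:
  fixes X :: "'a::metric_space set"
  assumes "compact X" "X \<noteq> {}" "c < 1"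
  obtains h :: "'a \<Rightarrow> l_infty"
  where "range h \<subseteq> c0" "1-lipschitz_on UNIV h"
    "\<And>x y. x \<in> X \<Longrightarrow> y \<in> X \<Longrightarrow> c * dist x y \<le> dist (h x) (h y)"
proof -
  obtain p :: "nat \<Rightarrow> 'a" and r :: "nat \<Rightarrow> real" where p: "range p \<subseteq> X" and r: "r \<longlonglongrightarrow> 0" "\<And>n. r n > 0"
    and net: "\<And>x k. x \<in> X \<Longrightarrow> \<exists>n. dist x (p n) < (1/2)^k \<and> r n = (1/2)^k"
    using compact_net_sequence[OF assms(1,2)] by metis
  define D where "D = max 1 (diameter X)"
  have D: "dist x y \<le> D" if "x \<in> X" "y \<in> X" for x y
    using diameter_bounded_bound[OF compact_imp_bounded[OF assms(1)] that] by (simp add: D_def)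
  define b where "b = (1 - c) / 2"
  have b: "b > 0" using assms(3) by (simp add: b_def)
  (* For the coarsest mesh with (1/2)^k <= b d, the factor 2 / b yields a cut-off of at least d,
     since the preceding mesh exceeds b d.  The factor D serves the case k = 0. *)
  define K where "K = max D (2 / b)"
  have K: "K \<ge> D" "K \<ge> 2 / b" "K > 0" by (auto simp: K_def D_def)
  define u where "u x n = min (dist x (p n)) (K * r n)" for x n
  have u_lim: "u x \<longlonglongrightarrow> 0" for x
  proof (rule Lim_null_comparison)
    show "(\<lambda>n. K * r n) \<longlonglongrightarrow> 0" using r(1) by (rule tendsto_mult_right_zero)
    show "\<forall>\<^sub>F n in sequentially. norm (u x n) \<le> K * r n"
      using K r(2) by (simp add: u_def less_imp_le)
  qed
  then have "u x \<in> bcontfun" for x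
    using convergent_imp_bounded by (auto simp: bcontfun_nat)
  then have h: "apply_bcontfun (Bcontfun (u x)) = u x" for x
    by (rule Bcontfun_inverse)
  show ?thesis
  proof
    show "range (\<lambda>x. Bcontfun (u x)) \<subseteq> c0" using u_lim by (auto simp: c0_def h)
    have "\<bar>u x n - u y n\<bar> \<le> dist x y" for x y n
      using abs_dist_diff_le_left[of x "p n" y] by (auto simp: u_def)
    then show "1-lipschitz_on UNIV (\<lambda>x. Bcontfun (u x))"
      by (intro lipschitz_onI dist_bound) (auto simp: h dist_real_def)
    fix x y assume xy: "x \<in> X" "y \<in> X"
    show "c * dist x y \<le> dist (Bcontfun (u x)) (Bcontfun (u y))"
    proof (cases "x = y")
      case False
      define d where "d = dist x y"
      have d: "d > 0" "d \<le> D" using False xy D by (auto simp: d_def)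
      have "\<exists>k. (1/2)^k \<le> b * d" using real_arch_pow_inv[of "b * d" "1/2"] b d by (auto intro: less_imp_le)
      then have "\<exists>k. (1/2)^k \<le> b * d \<and> d \<le> K * (1/2)^k"
      proof (rule exE[OF exists_least_iff[THEN iffD1]])
        fix k assume k: "(1/2)^k \<le> b * d \<and> (\<forall>j<k. \<not> (1/2)^j \<le> b * d)"
        have "d \<le> K * (1/2)^k"
        proof (cases k)
          case (Suc j)
          then have "b * d < (1/2)^j" using k by (auto simp: not_le)
          then have "d \<le> 2 / b * (1/2)^k" using b Suc by (simp add: field_simps)
          also have "\<dots> \<le> K * (1/2)^k" using K by (intro mult_right_mono) auto
          finally show ?thesis .
        qed (use d K in auto)
        then show ?thesis using k by blast
      qed
      then obtain k where k: "(1/2)^k \<le> b * d" "d \<le> K * (1/2)^k" by blast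
      obtain n where n: "dist x (p n) < (1/2)^k" "r n = (1/2)^k" using net[OF xy(1)] by blast
      have "c * d = d - b * d - b * d" by (simp add: b_def field_simps)
      also have "\<dots> \<le> u y n - u x n"
      proof -
        have "d - b * d \<le> dist y (p n)"
          using dist_triangle2[of x y "p n"] n k unfolding d_def by linarith
        moreover have "d - b * d \<le> K * r n"
          using k(2) mult_pos_pos[OF b d(1)] unfolding n(2) by linarith
        moreover have "u x n \<le> b * d" using n k by (simp add: u_def)
        ultimately show ?thesis unfolding u_def by linarith
      qed
      also have "\<dots> \<le> dist (Bcontfun (u x)) (Bcontfun (u y))"
        using dist_bounded[of "Bcontfun (u x)" n "Bcontfun (u y)"]
        by (simp add: h dist_real_def)
      finally show ?thesis by (simp add: d_def)
    qed simp
  qed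
qed

section \<open>Isometric embedding of a fractal into C[0,1]\<close>

text \<open>
  The interval \<open>[0,1]\<close> is cut into \<open>2 m + 1\<close> equal pieces, and the letter \<open>i < m\<close> stands for the affine
  map onto the piece number \<open>2 i + 1\<close>, counted from \<open>0\<close>.  A word acts by composition, and its
  address is the image of \<open>0\<close>.  The pieces with even number separate different first letters from
  each other, and the piece number \<open>0\<close> separates the non-empty words from the empty one.
\<close>

primrec address :: "nat \<Rightarrow> nat list \<Rightarrow> real" where
  "address m [] = 0"
| "address m (i # w) = (address m w + 2 * real i + 1) / (2 * real m + 1)"

lemma address_bounds: "w \<in> lists {..<m} \<Longrightarrow> 0 \<le> address m w \<and> address m w \<le> 1"
proof (induction w)
  case (Cons i w)
  then have "real i + 1 \<le> real m" by auto
  with Cons show ?case by (auto simp: divide_le_eq)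
qed simp

lemma address_gap:
  assumes "i # w \<in> lists {..<m}" "v \<in> lists {..<m}" "\<And>v'. v \<noteq> i # v'"
  shows "1 / (2 * real m + 1) \<le> \<bar>address m (i # w) - address m v\<bar>"
proof (cases v)
  case Nil
  then show ?thesis using address_bounds[of w m] assms(1) by (simp add: divide_right_mono)
next
  case (Cons j v')
  have "w \<in> lists {..<m}" "v' \<in> lists {..<m}" using assms Cons by auto
  then have bounds: "\<bar>address m w - address m v'\<bar> \<le> 1"
    using address_bounds[of w m] address_bounds[of v' m] by (simp add: abs_le_iff)
  have "1 \<le> \<bar>real i - real j\<bar>" using assms(3) Cons by (cases i j rule: linorder_cases) auto
  then have "2 \<le> \<bar>2 * (real i - real j)\<bar>" by (simp add: abs_mult)
  then have "1 \<le> \<bar>address m w - address m v' + 2 * (real i - real j)\<bar>"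
    using bounds abs_triangle_ineq2_sym[of "address m w - address m v'" "- (2 * (real i - real j))"]
    by simp
  moreover have "address m (i # w) - address m v
      = (address m w - address m v' + 2 * (real i - real j)) / (2 * real m + 1)"
    by (simp add: Cons diff_divide_distrib[symmetric] algebra_simps)
  ultimately show ?thesis by (simp add: divide_right_mono)
qed

text \<open>
  A common first letter contracts the distance of the points by \<open>c\<close> and that of the addresses
  exactly by \<open>\<rho> = 1 / (2 m + 1)\<close>; different first letters keep the addresses \<open>\<rho>\<close> apart, and then
  the diameter bound \<open>D\<close> is enough.  So the exponent with \<open>\<rho> powr \<alpha> = c\<close> works, by induction on
  the words.
\<close>

lemma coding_Hoelder:
  fixes f :: "nat \<Rightarrow> 'a::metric_space \<Rightarrow> 'a"
  assumes "m > 0" "x0 \<in> X" and f: "\<And>i. i < m \<Longrightarrow> c-lipschitz_on X (f i)" "\<And>i. i < m \<Longrightarrow> f i ` X \<subseteq> X"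
    and c: "0 < c" "c < 1" and D: "\<And>x y. x \<in> X \<Longrightarrow> y \<in> X \<Longrightarrow> dist x y \<le> D"
  shows "\<exists>\<alpha>>0. \<forall>w\<in>lists {..<m}. \<forall>v\<in>lists {..<m}.
    dist (foldr f w x0) (foldr f v x0) \<le> D / c * \<bar>address m w - address m v\<bar> powr \<alpha>"
proof -
  define \<rho> where "\<rho> = 1 / (2 * real m + 1)"
  have \<rho>: "0 < \<rho>" "\<rho> < 1" using assms(1) by (auto simp: \<rho>_def)
  define \<alpha> where "\<alpha> = ln c / ln \<rho>"
  have \<alpha>: "\<alpha> > 0" using c \<rho> by (auto simp: \<alpha>_def intro!: divide_neg_neg)
  have \<rho>\<alpha>: "\<rho> powr \<alpha> = c" using c \<rho> by (simp add: powr_def \<alpha>_def)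
  have D0: "D \<ge> 0" using D[of x0 x0] assms(2) by simp
  have pt: "foldr f w x0 \<in> X" if "w \<in> lists {..<m}" for w
    using that by (induction w) (use assms(2) f(2) in auto)
  have far: "dist (foldr f w x0) (foldr f v x0) \<le> D / c * \<bar>address m w - address m v\<bar> powr \<alpha>"
    if "w \<in> lists {..<m}" "v \<in> lists {..<m}" "\<rho> \<le> \<bar>address m w - address m v\<bar>" for w v
  proof -
    have "D = D / c * \<rho> powr \<alpha>" using c by (simp add: \<rho>\<alpha>)
    also have "\<dots> \<le> D / c * \<bar>address m w - address m v\<bar> powr \<alpha>"
      using that c D0 \<alpha> \<rho> by (intro mult_left_mono powr_mono2) auto
    finally show ?thesis using D[OF pt[OF that(1)] pt[OF that(2)]] by linarith
  qed
  have "dist (foldr f w x0) (foldr f v x0) \<le> D / c * \<bar>address m w - address m v\<bar> powr \<alpha>"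
    if "w \<in> lists {..<m}" "v \<in> lists {..<m}" for w v
    using that
  proof (induction w arbitrary: v)
    case Nil
    show ?case
    proof (cases v)
      case (Cons j v')
      then have "\<rho> \<le> \<bar>address m v - address m []\<bar>"
        using address_gap[of j v' m "[]"] Nil by (simp add: \<rho>_def)
      then show ?thesis using far[of "[]" v] Nil by (simp add: abs_minus_commute)
    qed simp
  next
    case (Cons i w)
    show ?case
    proof (cases "\<exists>v'. v = i # v'")
      case True
      then obtain v' where v: "v = i # v'" by blast
      have w: "i < m" "w \<in> lists {..<m}" "v' \<in> lists {..<m}"
        using Cons.hyps Cons.prems v by auto
      have "dist (foldr f (i # w) x0) (foldr f v x0) \<le> c * dist (foldr f w x0) (foldr f v' x0)"
        using lipschitz_onD[OF f(1)[OF w(1)] pt[OF w(2)] pt[OF w(3)]] v by simp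
      also have "\<dots> \<le> \<rho> powr \<alpha> * (D / c * \<bar>address m w - address m v'\<bar> powr \<alpha>)"
        unfolding \<rho>\<alpha> using Cons.IH[OF w(3)] c by (intro mult_left_mono) auto
      also have "\<dots> = D / c * (\<rho> * \<bar>address m w - address m v'\<bar>) powr \<alpha>"
        using \<rho> by (simp add: powr_mult)
      also have "\<rho> * \<bar>address m w - address m v'\<bar> = \<bar>address m (i # w) - address m v\<bar>"
        using \<rho>(1) by (simp add: v \<rho>_def diff_divide_distrib[symmetric])
      finally show ?thesis .
    next
      case False
      then show ?thesis using address_gap[of i w m v] Cons.hyps Cons.prems by (intro far) (auto simp: \<rho>_def)
    qed
  qed
  then show ?thesis using \<alpha> by blast
qed

text \<open>
  Every \<open>x\<close> has the form \<open>f i y\<close>, and \<open>f i\<close> contracts an approximation of \<open>y\<close> by the factor \<open>c\<close>.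
\<close>

lemma coding_dense:
  fixes f :: "nat \<Rightarrow> 'a::metric_space \<Rightarrow> 'a"
  assumes "x0 \<in> X" and f: "\<And>i. i < m \<Longrightarrow> c-lipschitz_on X (f i)" and X: "X = (\<Union>i<m. f i ` X)"
    and c: "0 < c" and D: "\<And>x y. x \<in> X \<Longrightarrow> y \<in> X \<Longrightarrow> dist x y \<le> D" and "x \<in> X"
  shows "\<exists>w\<in>lists {..<m}. dist (foldr f w x0) x \<le> c ^ n * D"
  using \<open>x \<in> X\<close>
proof (induction n arbitrary: x)
  case 0
  then show ?case using D[of x0 x] assms(1) by (intro bexI[of _ "[]"]) auto
next
  case (Suc n)
  have pt: "foldr f w x0 \<in> X" if "w \<in> lists {..<m}" for w
    using that by (induction w) (use assms(1) X in auto)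
  obtain i y where i: "i < m" "y \<in> X" "x = f i y"
    using equalityD1[OF X, THEN subsetD, OF Suc.prems] by blast
  then obtain w where w: "w \<in> lists {..<m}" "dist (foldr f w x0) y \<le> c ^ n * D" using Suc.IH by blast
  have "dist (foldr f (i # w) x0) x \<le> c * dist (foldr f w x0) y"
    using lipschitz_onD[OF f[OF i(1)] pt[OF w(1)] i(2)] i by simp
  also have "\<dots> \<le> c * (c ^ n * D)" using w c by (intro mult_left_mono) auto
  finally show ?case using w i by (intro bexI[of _ "i # w"]) (auto simp: mult.assoc)
qed

text \<open>
  For a compact space this is the theorem of Banach and Mazur; the family of contractions takes
  over the role of a continuous surjection from the Cantor set onto \<open>X\<close>.  The function
  \<open>u x t\<close> is 1-Lipschitz in \<open>x\<close>, as each term is, and continuous in \<open>t\<close>, because \<open>\<omega>\<close> is uniformly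
  continuous on \<open>[0,1]\<close>.  At the address of \<open>w\<close> its value is \<open>dist x (pt w)\<close>: the term for \<open>w\<close>
  gives one inequality, and the Hoelder estimate the other.  As the points \<open>pt w\<close> are dense,
  these values alone recover the distances in \<open>X\<close>.
\<close>

lemma isometric_embedding_C01:
  fixes f :: "nat \<Rightarrow> 'a::metric_space \<Rightarrow> 'a"
  assumes "compact X" "X \<noteq> {}" and f: "\<And>i. i < m \<Longrightarrow> c-lipschitz_on X (f i)"
    and X: "X = (\<Union>i<m. f i ` X)" and c: "0 < c" "c < 1"
  shows "\<exists>h :: 'a \<Rightarrow> C01. \<forall>x\<in>X. \<forall>y\<in>X. dist (h x) (h y) = dist x y"
proof -
  obtain x0 where x0: "x0 \<in> X" using assms(2) by blast
  have m: "m > 0" using X assms(2) by (cases m) auto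
  obtain D where D: "\<And>x y. x \<in> X \<Longrightarrow> y \<in> X \<Longrightarrow> dist x y \<le> D"
    using compact_imp_bounded[OF assms(1)] diameter_bounded_bound by metis
  have D0: "D \<ge> 0" using D[OF x0 x0] by simp
  define W where "W = lists {..<m}"
  define pt where "pt w = foldr f w x0" for w
  have fX: "f i ` X \<subseteq> X" if "i < m" for i using X that by blast
  have "\<exists>\<alpha>>0. \<forall>w\<in>W. \<forall>v\<in>W. dist (pt w) (pt v) \<le> D / c * \<bar>address m w - address m v\<bar> powr \<alpha>"
    unfolding W_def pt_def by (rule coding_Hoelder[where X = X]) (fact m x0 f fX c D)+
  then obtain \<alpha> where \<alpha>: "\<alpha> > 0" and hoelder: "\<And>w v. w \<in> W \<Longrightarrow> v \<in> W \<Longrightarrow>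
      dist (pt w) (pt v) \<le> D / c * \<bar>address m w - address m v\<bar> powr \<alpha>"
    by blast
  define \<omega> where "\<omega> s = D / c * s powr \<alpha>" for s
  have \<omega>: "\<omega> 0 = 0" "\<And>s. 0 \<le> \<omega> s" using \<alpha> D0 c by (auto simp: \<omega>_def)
  have "continuous_on {0..1} \<omega>"
    unfolding \<omega>_def using \<alpha>
    by (intro continuous_on_mult continuous_on_const continuous_on_powr' continuous_on_id) auto
  then have \<omega>_uc: "uniformly_continuous_on {0..1} \<omega>"
    by (rule compact_uniformly_continuous) simp
  define u where "u x t = (INF w\<in>W. dist x (pt w) + \<omega> \<bar>t - address m w\<bar>)" for x t
  have W: "W \<noteq> {}" by (auto simp: W_def)
  have bdd: "bdd_below ((\<lambda>w. dist x (pt w) + \<omega> \<bar>t - address m w\<bar>) ` W)" for x t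
    by (rule bdd_belowI2[of _ 0]) (simp add: \<omega>)
  have u_lip: "\<bar>u x t - u y t\<bar> \<le> dist x y" for x y t
    unfolding u_def
  proof (rule abs_INF_diff_le[OF W bdd bdd])
    fix w
    show "\<bar>dist x (pt w) + \<omega> \<bar>t - address m w\<bar> - (dist y (pt w) + \<omega> \<bar>t - address m w\<bar>)\<bar> \<le> dist x y"
      using abs_dist_diff_le_left[of x "pt w" y] by simp
  qed
  have u_cont: "continuous_on {0..1} (u x)" for x
    unfolding continuous_on_iff
  proof (intro ballI allI impI)
    fix s e :: real assume s: "s \<in> {0..1}" and "e > 0"
    obtain d where d: "d > 0" "\<And>a b. a \<in> {0..1} \<Longrightarrow> b \<in> {0..1} \<Longrightarrow> dist b a < d \<Longrightarrow> dist (\<omega> b) (\<omega> a) < e / 2"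
      using uniformly_continuous_onE[OF \<omega>_uc, of "e / 2"] \<open>e > 0\<close> by (metis half_gt_zero)
    have "dist (u x t) (u x s) < e" if t: "t \<in> {0..1}" "dist t s < d" for t
    proof -
      have "\<bar>u x t - u x s\<bar> \<le> e / 2"
        unfolding u_def
      proof (rule abs_INF_diff_le[OF W bdd bdd])
        fix w assume "w \<in> W"
        then have "0 \<le> address m w" "address m w \<le> 1" using address_bounds by (auto simp: W_def)
        then have "dist (\<omega> \<bar>t - address m w\<bar>) (\<omega> \<bar>s - address m w\<bar>) < e / 2"
          using s t by (intro d(2)) (auto simp: dist_real_def)
        then show "\<bar>dist x (pt w) + \<omega> \<bar>t - address m w\<bar> - (dist x (pt w) + \<omega> \<bar>s - address m w\<bar>)\<bar> \<le> e / 2"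
          by (simp add: dist_real_def)
      qed
      then show ?thesis using \<open>e > 0\<close> by (simp add: dist_real_def)
    qed
    then show "\<exists>d>0. \<forall>t\<in>{0..1}. dist t s < d \<longrightarrow> dist (u x t) (u x s) < e" using d(1) by blast
  qed
  have u_address: "u x (address m w) = dist x (pt w)" if "w \<in> W" for x w
  proof (rule antisym)
    show "u x (address m w) \<le> dist x (pt w)"
      unfolding u_def using cINF_lower[OF bdd that, of x "address m w"] by (simp add: \<omega>)
    show "dist x (pt w) \<le> u x (address m w)"
      unfolding u_def
    proof (rule cINF_greatest[OF W])
      fix v assume "v \<in> W"
      then show "dist x (pt w) \<le> dist x (pt v) + \<omega> \<bar>address m w - address m v\<bar>"
        using hoelder[OF that, of v] dist_triangle2[of x "pt w" "pt v"] by (simp add: \<omega>_def)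
    qed
  qed
  define h where "h x = Bcontfun (\<lambda>t. u x (Rep_unit_interval t))" for x
  have h: "h x t = u x (Rep_unit_interval t)" for x t
  proof -
    have "continuous_on UNIV (\<lambda>t. u x (Rep_unit_interval t))"
      using homeomorphism_unit_interval
      by (intro continuous_on_compose2[OF u_cont]) (auto simp: homeomorphism_def)
    then show ?thesis by (simp add: h_def Bcontfun_inverse bcontfun_unit_interval)
  qed
  show ?thesis
  proof (intro exI[of _ h] ballI antisym)
    fix x y assume "x \<in> X" "y \<in> X"
    show "dist (h x) (h y) \<le> dist x y"
      using u_lip by (intro dist_bound) (simp add: h dist_real_def)
    show "dist x y \<le> dist (h x) (h y)"
    proof (rule field_le_epsilon)
      fix e :: real assume "e > 0"
      have "(\<lambda>n. c ^ n * D) \<longlonglongrightarrow> 0" using c by (intro tendsto_mult_left_zero LIMSEQ_power_zero) auto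
      from order_tendstoD(2)[OF this, of "e / 2"]
      have "\<forall>\<^sub>F n in sequentially. c ^ n * D < e / 2" using \<open>e > 0\<close> by simp
      then obtain n where n: "c ^ n * D < e / 2"
        using eventually_happens'[OF sequentially_bot] by blast
      have "\<exists>w\<in>W. dist (pt w) x \<le> c ^ n * D"
        unfolding W_def pt_def by (rule coding_dense[where X = X]) (fact x0 f X c(1) D \<open>x \<in> X\<close>)+
      then obtain w where w: "w \<in> W" "dist (pt w) x \<le> c ^ n * D" by blast
      have t: "Rep_unit_interval (Abs_unit_interval (address m w)) = address m w"
        using address_bounds w by (intro Abs_unit_interval_inverse) (auto simp: W_def)
      have "\<bar>dist x (pt w) - dist y (pt w)\<bar> \<le> dist (h x) (h y)"
        using dist_bounded[of "h x" "Abs_unit_interval (address m w)" "h y"]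
        by (simp add: h t u_address w dist_real_def)
      then show "dist x y \<le> dist (h x) (h y) + e"
        using n w dist_triangle2[of x y "pt w"] unfolding dist_commute[of "pt w" x] by linarith
    qed
  qed
qed

section \<open>Fractals in \<open>C[0,1]\<close>, \<open>\<ell>\<^sub>\<infinity>\<close> and \<open>c\<^sub>0\<close>\<close>

text \<open>
  As \<open>F\<close> is finite, the largest of its Lipschitz constants is still less than \<open>1\<close>.  The number
  \<open>1/2\<close> is added to keep the ratio positive, as a Hoelder exponent is going to be formed from its
  logarithm.
\<close>

lemma metric_fractal_uniform_ratio:
  assumes "metric_fractal X F"
  obtains q where "0 < q" "q < 1" "\<And>f. f \<in> F \<Longrightarrow> q-lipschitz_on X f"
proof -
  have "\<forall>f\<in>F. \<exists>C<1. C-lipschitz_on X f"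
    using assms by (auto simp: metric_fractal_def contracting_self_maps_def simp flip: Lip_less_1_iff)
  then obtain C where C: "\<And>f. f \<in> F \<Longrightarrow> C f < 1" "\<And>f. f \<in> F \<Longrightarrow> (C f)-lipschitz_on X f" by metis
  have fin: "finite (insert (1/2) (C ` F))" using assms by (simp add: metric_fractal_def)
  define q where "q = Max (insert (1/2) (C ` F))"
  show ?thesis
  proof
    have "1/2 \<le> q" unfolding q_def using fin by (intro Max_ge) auto
    then show "0 < q" by simp
    show "q < 1" using C fin by (auto simp: q_def)
    show "q-lipschitz_on X f" if "f \<in> F" for f
      using C(2)[OF that] by (rule lipschitz_on_le) (use fin that in \<open>auto simp: q_def\<close>)
  qed
qed

lemma isometric_fractal_in_bcontfun:
  fixes h :: "'a::metric_space \<Rightarrow> ('t::topological_space \<Rightarrow>\<^sub>C real)"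
  assumes X: "metric_fractal X F"
    and h: "\<And>x y. x \<in> X \<Longrightarrow> y \<in> X \<Longrightarrow> dist (h x) (h y) = dist x y"
  shows "\<exists>L G. fractal_in (UNIV :: ('t \<Rightarrow>\<^sub>C real) set) L G \<and> isometrically_equivalent X F L G"
proof -
  obtain q where q: "0 < q" "q < 1" "\<And>f. f \<in> F \<Longrightarrow> q-lipschitz_on X f"
    using metric_fractal_uniform_ratio[OF X] by metis
  have h1: "1-lipschitz_on X h" using h by (auto simp: lipschitz_on_def)
  have cL: "compact (h ` X)"
    using X compact_continuous_image[OF lipschitz_on_continuous_on[OF h1]]
    by (simp add: metric_fractal_def)
  obtain G where "fractal_in UNIV (h ` X) G" "conjugates_family X F (h ` X) G h"
  proof (rule fractal_in_of_embedding[OF X complete_bcontfun _ q(3), where c = 1 and h = h])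
    fix g :: "('t \<Rightarrow>\<^sub>C real) \<Rightarrow> ('t \<Rightarrow>\<^sub>C real)" assume g: "(q/1)-lipschitz_on (h ` X) g"
    show "\<exists>G. (q/1)-lipschitz_on UNIV G \<and> G ` UNIV \<subseteq> UNIV \<and> (\<forall>x\<in>h ` X. G x = g x)"
      using lipschitz_extension_bcontfun[OF cL g] by (metis subset_UNIV)
  qed (use q h h1 in auto)
  then show ?thesis using h unfolding isometrically_equivalent_def by blast
qed

theorem corollary2p4:
  fixes X :: "'a::metric_space set" and F :: "('a \<Rightarrow> 'a) set"
  assumes "metric_fractal X F"
  shows "(\<exists>(L :: C01 set) G. fractal_in UNIV L G \<and> isometrically_equivalent X F L G) \<and>
         (\<exists>(L :: l_infty set) G. fractal_in UNIV L G \<and> isometrically_equivalent X F L G) \<and>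
         (\<exists>(L :: l_infty set) G. fractal_in c0 L G \<and> bi_Lipschitz_equivalent X F L G)"
proof (intro conjI)
  have X: "compact X" "X \<noteq> {}" "finite F" "X = (\<Union>f\<in>F. f ` X)"
    using assms by (auto simp: metric_fractal_def)
  obtain q where q: "0 < q" "q < 1" "\<And>f. f \<in> F \<Longrightarrow> q-lipschitz_on X f"
    using metric_fractal_uniform_ratio[OF assms] by metis
  show "\<exists>(L :: C01 set) G. fractal_in UNIV L G \<and> isometrically_equivalent X F L G"
  proof -
    obtain f where "bij_betw f {0..<card F} F" using ex_bij_betw_nat_finite[OF X(3)] by blast
    then have f: "F = f ` {..<card F}" by (simp add: bij_betw_def atLeast0LessThan)
    have lip: "q-lipschitz_on X (f i)" if "i < card F" for i
      using q(3) f that by blast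
    have "(\<Union>g\<in>F. g ` X) = (\<Union>i<card F. f i ` X)" by (subst f) simp
    with X(4) have union: "X = (\<Union>i<card F. f i ` X)" by simp
    have "\<exists>h :: 'a \<Rightarrow> C01. \<forall>x\<in>X. \<forall>y\<in>X. dist (h x) (h y) = dist x y"
      by (rule isometric_embedding_C01[where f = f and m = "card F" and c = q])
        (fact X(1,2) lip union q(1,2))+
    then obtain h :: "'a \<Rightarrow> C01" where "\<And>x y. x \<in> X \<Longrightarrow> y \<in> X \<Longrightarrow> dist (h x) (h y) = dist x y"
      by blast
    then show ?thesis by (rule isometric_fractal_in_bcontfun[OF assms])
  qed
  show "\<exists>(L :: l_infty set) G. fractal_in UNIV L G \<and> isometrically_equivalent X F L G"
  proof -
    obtain h :: "'a \<Rightarrow> l_infty" where "\<And>x y. x \<in> X \<Longrightarrow> y \<in> X \<Longrightarrow> dist (h x) (h y) = dist x y"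
      using isometric_embedding_l_infty[OF X(1,2)] by metis
    then show ?thesis by (rule isometric_fractal_in_bcontfun[OF assms])
  qed
  show "\<exists>(L :: l_infty set) G. fractal_in c0 L G \<and> bi_Lipschitz_equivalent X F L G"
  proof -
    (* Any c strictly between q and 1 would do. *)
    define c where "c = (1 + q) / 2"
    have c: "0 < c" "c < 1" "q / c < 1" using q(1,2) by (auto simp: c_def)
    obtain h :: "'a \<Rightarrow> l_infty" where h: "range h \<subseteq> c0" "1-lipschitz_on UNIV h"
      "\<And>x y. x \<in> X \<Longrightarrow> y \<in> X \<Longrightarrow> c * dist x y \<le> dist (h x) (h y)"
      using almost_isometric_embedding_c0[OF X(1,2) c(2)] by metis
    have h1: "1-lipschitz_on X h" using h(2) by (rule lipschitz_on_subset) simp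
    have cL: "compact (h ` X)"
      using X(1) compact_continuous_image[OF lipschitz_on_continuous_on[OF h1]] by simp
    obtain G where "fractal_in c0 (h ` X) G" "conjugates_family X F (h ` X) G h"
    proof (rule fractal_in_of_embedding[OF assms _ _ q(3) c(1,3) h(3) h1])
      show "complete c0" by (rule complete_closed_subset[OF closed_c0 subset_UNIV complete_bcontfun])
      fix g assume g: "(q/c)-lipschitz_on (h ` X) g" "g ` h ` X \<subseteq> h ` X"
      then obtain G where "(q/c)-lipschitz_on UNIV G" "range G \<subseteq> c0" "\<And>x. x \<in> h ` X \<Longrightarrow> G x = g x"
        using lipschitz_extension_c0[OF cL g(1)] h(1) by (metis image_mono subset_UNIV subset_trans)
      then show "\<exists>G. (q/c)-lipschitz_on c0 G \<and> G ` c0 \<subseteq> c0 \<and> (\<forall>x\<in>h ` X. G x = g x)"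
        by (intro exI[of _ G]) (auto intro: lipschitz_on_subset)
    qed (use h(1) in auto)
    moreover have "dist (h x) (h y) \<le> 1 * dist x y" if "x \<in> X" "y \<in> X" for x y
      using lipschitz_onD[OF h1 that] .
    ultimately show ?thesis
      using h(3) c(1) unfolding bi_Lipschitz_equivalent_def by (metis zero_less_one)
  qed
qed

end
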